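(* Let $s>1$ be a fixed natural number, $A=\{0,1,\dots,s-1\}$, and let $N_B\subseteq\mathbb{N}$ be a fixed subset. Put $\delta_n=2$ if $n\notin N_B$ and $\delta_n=1$ if $n\in N_B$. Let $$x'_0=-\sum_{n\in N_B}\frac{s-1}{s^n},\qquad x''_0=\sum_{n\in\mathbb{N}\setminus N_B}\frac{s-1}{s^n}.$$ Then for every $x\in[x'_0;x''_0]$ there exists a sequence $(\alpha_n)$ with $\alpha_n\in A$ for all $n$ such that $$x=\sum_{n=1}^{\infty}\frac{(-1)^{\delta_n}\alpha_n}{s^n}.$$
   Context: A representation of $x$ in the form $x=\sum_{n\ge1}(-1)^{\delta_n}\alpha_n s^{-n}$ with $\alpha_n\in A$ is called a quasi-nega-$s$-ary representation of $x$ and is denoted $x=\Delta^{(\pm s,B)}_{\alpha_1\alpha_2\dots\alpha_n\dots}$. Note $x''_0=1-\sum_{n\in N_B}\frac{s-1}{s^n}$; $x'_0$ and $x''_0$ are the infimum and supremum of all such series. *)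

theory Defs
  imports "HOL-Analysis.Analysis"
begin

text \<open>Positions are indexed from 1, so the set of natural numbers is \<^term>\<open>{1::nat..}\<close>.\<close>

definition digit_set :: "nat \<Rightarrow> nat set" where
  "digit_set s = {0..s - 1}"

definition delta :: "nat set \<Rightarrow> nat \<Rightarrow> nat" where
  "delta N\<^sub>B n = (if n \<in> N\<^sub>B then 1 else 2)"

definition x0_inf :: "nat \<Rightarrow> nat set \<Rightarrow> real" where
  "x0_inf s N\<^sub>B = - (\<Sum>\<^sub>\<infinity>n\<in>N\<^sub>B. (real s - 1) / real s ^ n)"

definition x0_sup :: "nat \<Rightarrow> nat set \<Rightarrow> real" where
  "x0_sup s N\<^sub>B = (\<Sum>\<^sub>\<infinity>n\<in>{1..} - N\<^sub>B. (real s - 1) / real s ^ n)"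

text \<open>The infinite sums above are genuine: they never fall back to the default value 0 of
  \<^const>\<open>infsum\<close>.\<close>

lemma summable_on_x0:
  fixes s :: nat and M :: "nat set"
  assumes "s > 1"
  shows "(\<lambda>n. (real s - 1) / real s ^ n) summable_on M"
proof -
  have "summable (\<lambda>n. (1 / real s) ^ n)"
    using assms by (intro summable_geometric) auto
  then have "summable (\<lambda>n. (real s - 1) * (1 / real s) ^ n)"
    by (rule summable_mult)
  then have "summable (\<lambda>n. (real s - 1) / real s ^ n)"
    by (simp add: power_one_over field_simps)
  then have "(\<lambda>n. (real s - 1) / real s ^ n) summable_on UNIV"
    using assms by (intro summable_nonneg_imp_summable_on) auto
  then show ?thesis
    by (rule summable_on_subset_banach) simp
qed

end

theory Submission
  imports Defs
begin

text \<open>Translating by \<open>- x0_inf\<close> maps the interval onto \<open>[0, 1]\<close>, and reflecting the digits at the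
  positions of \<open>N\<^sub>B\<close> (\<open>\<beta> \<mapsto> s - 1 - \<beta>\<close>) turns an ordinary \<open>s\<close>-ary expansion of the
  translated point into a quasi-nega-\<open>s\<close>-ary expansion of the original one.\<close>

text \<open>One step of the greedy algorithm: the integer part of \<open>s * r\<close> is the digit
  and the fractional part is the next remainder. The remainders range over the closed interval so
  that the right endpoint is covered and the step can be iterated.\<close>

lemma exists_next_digit:
  fixes s :: nat and r :: real
  assumes "s > 1" "r \<in> {0..1}"
  shows "\<exists>d\<in>digit_set s. real s * r - real d \<in> {0..1}"
proof (cases "r = 1")
  \<comment> \<open>Here the floor would be \<open>s\<close>, which is not a digit; the digit
    \<open>s - 1\<close> leaves the remainder 1 again.\<close>
  case True
  then show ?thesis
    using assms by (intro bexI[of _ "s - 1"]) (auto simp: digit_set_def of_nat_diff)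
next
  case False
  define d where "d = nat \<lfloor>real s * r\<rfloor>"
  have d: "real d = of_int \<lfloor>real s * r\<rfloor>"
    using assms by (simp add: d_def)
  then have "real d \<le> real s * r" "real s * r < real d + 1"
    by linarith+
  moreover have "real s * r < real s"
    using False assms by simp
  ultimately have "d < s"
    by linarith
  then show ?thesis
    using \<open>real d \<le> real s * r\<close> \<open>real s * r < real d + 1\<close>
    by (intro bexI[of _ d]) (auto simp: digit_set_def)
qed

text \<open>Iterating the greedy step from \<open>y\<close> leaves after \<open>n\<close> digits an
  error of \<open>R n / s ^ n\<close>, which tends to 0 because all remainders stay in the unit
  interval.\<close>

lemma exists_s_ary_expansion:
  fixes s :: nat and y :: real
  assumes "s > 1" "y \<in> {0..1}"
  shows "\<exists>\<beta> :: nat \<Rightarrow> nat. (\<forall>k. \<beta> k \<in> digit_set s) \<and> (\<lambda>k. real (\<beta> k) / real s ^ Suc k) sums y"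
proof -
  obtain d where d: "\<And>r. r \<in> {0..1} \<Longrightarrow> d r \<in> digit_set s \<and> real s * r - real (d r) \<in> {0..1}"
    using exists_next_digit[OF assms(1)] by metis
  \<comment> \<open>\<open>R n\<close> is the error after \<open>n\<close> digits, scaled up by
    \<open>s ^ n\<close>.\<close>
  define R where "R = rec_nat y (\<lambda>_ r. real s * r - real (d r))"
  have R_simps: "R 0 = y" "R (Suc n) = real s * R n - real (d (R n))" for n
    by (simp_all add: R_def)
  have R: "R n \<in> {0..1}" for n
    using assms(2) d by (induction n) (auto simp: R_simps)
  have partial_sum: "(\<Sum>k<n. real (d (R k)) / real s ^ Suc k) = y - R n / real s ^ n" for n
  proof (induction n)
    case (Suc n)
    have "R (Suc n) / real s ^ Suc n = R n / real s ^ n - real (d (R n)) / real s ^ Suc n"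
      using assms(1) by (simp add: R_simps diff_divide_distrib)
    with Suc show ?case
      by simp
  qed (simp add: R_simps)
  have "(\<lambda>n. R n / real s ^ n) \<longlonglongrightarrow> 0"
  proof (rule tendsto_sandwich[where f = "\<lambda>_. 0" and h = "\<lambda>n. (1 / real s) ^ n"])
    show "(\<lambda>n. (1 / real s) ^ n) \<longlonglongrightarrow> 0"
      using assms(1) by (intro LIMSEQ_power_zero) auto
    show "\<forall>\<^sub>F n in sequentially. R n / real s ^ n \<le> (1 / real s) ^ n"
    proof (rule always_eventually, rule allI)
      show "R n / real s ^ n \<le> (1 / real s) ^ n" for n
        unfolding power_one_over using R[of n] by (intro divide_right_mono) auto
    qed
    show "\<forall>\<^sub>F n in sequentially. 0 \<le> R n / real s ^ n"
      using R by (intro always_eventually) simp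
  qed simp
  then have "(\<lambda>n. y - R n / real s ^ n) \<longlonglongrightarrow> y - 0"
    by (intro tendsto_intros)
  then have "(\<lambda>k. real (d (R k)) / real s ^ Suc k) sums y"
    unfolding sums_def partial_sum by simp
  with d[OF R] show ?thesis
    by (intro exI[of _ "\<lambda>k. d (R k)"]) simp
qed

text \<open>Bridges the unordered sums over sets of positions, which define the endpoints, and the
  ordered series, whose index \<open>k\<close> stands for position \<open>Suc k\<close>.\<close>

lemma infsum_positive_positions_sums:
  fixes f :: "nat \<Rightarrow> real"
  assumes "f summable_on M" "M \<subseteq> {1..}"
  shows "(\<lambda>k. if Suc k \<in> M then f (Suc k) else 0) sums infsum f M"
proof -
  have "((\<lambda>n. if n \<in> M then f n else 0) has_sum infsum f M) UNIV"
    using has_sum_infsum[OF assms(1)]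
    by (rule has_sum_cong_neutral[THEN iffD1, rotated -1]) auto
  then have "(\<lambda>n. if n \<in> M then f n else 0) sums infsum f M"
    by (rule has_sum_imp_sums)
  \<comment> \<open>The term at index 0 therefore vanishes, and dropping it by the shift leaves the
    sum unchanged.\<close>
  moreover have "0 \<notin> M"
    using assms(2) by auto
  ultimately show ?thesis
    by (subst sums_Suc_iff) simp
qed

text \<open>The two endpoint sums split the geometric series over all positions, whose value is
  1.\<close>

lemma x0_sup_eq:
  fixes s :: nat
  assumes "s > 1" "N\<^sub>B \<subseteq> {1..}"
  shows "x0_sup s N\<^sub>B = x0_inf s N\<^sub>B + 1"
proof -
  let ?f = "\<lambda>n. (real s - 1) / real s ^ n"
  have "(\<lambda>k. ((real s - 1) / real s) * (1 / real s) ^ k) sums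
      (((real s - 1) / real s) * (1 / (1 - 1 / real s)))"
    using assms(1) by (intro sums_mult geometric_sums) auto
  moreover have "((real s - 1) / real s) * (1 / (1 - 1 / real s)) = 1"
    using assms(1) by (simp add: field_simps)
  ultimately have "(\<lambda>k. ?f (Suc k)) sums 1"
    using assms(1) by (simp add: power_one_over)
  moreover have "(\<lambda>k. ?f (Suc k)) sums infsum ?f {1..}"
    using infsum_positive_positions_sums[OF summable_on_x0[OF assms(1)], of "{1..}"] by simp
  ultimately have "infsum ?f {1..} = 1"
    by (rule sums_unique2[symmetric])
  moreover have "infsum ?f ({1..} - N\<^sub>B) = infsum ?f {1..} - infsum ?f N\<^sub>B"
    using assms by (intro infsum_Diff summable_on_x0)
  ultimately show ?thesis
    by (simp add: x0_sup_def x0_inf_def)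
qed

theorem theorem1:
  fixes s :: nat and N\<^sub>B :: "nat set" and x :: real
  assumes "s > 1"
    and "N\<^sub>B \<subseteq> {1..}"
    and "x \<in> {x0_inf s N\<^sub>B..x0_sup s N\<^sub>B}"
  shows "\<exists>\<alpha> :: nat \<Rightarrow> nat. (\<forall>n\<ge>1. \<alpha> n \<in> digit_set s) \<and>
    (\<lambda>k. (-1) ^ delta N\<^sub>B (Suc k) * real (\<alpha> (Suc k)) / real s ^ Suc k) sums x"
proof -
  let ?f = "\<lambda>n. (real s - 1) / real s ^ n"
  have "x - x0_inf s N\<^sub>B \<in> {0..1}"
    using assms(3) x0_sup_eq[OF assms(1,2)] by simp
  then obtain \<beta> :: "nat \<Rightarrow> nat" where \<beta>: "\<And>k. \<beta> k \<in> digit_set s"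
    and sums_\<beta>: "(\<lambda>k. real (\<beta> k) / real s ^ Suc k) sums (x - x0_inf s N\<^sub>B)"
    using exists_s_ary_expansion[OF assms(1)] by blast
  \<comment> \<open>The digits \<open>\<beta>\<close> are indexed from 0, so position
    \<open>n\<close> carries \<open>\<beta> (n - 1)\<close>.\<close>
  define \<alpha> where "\<alpha> n = (if n \<in> N\<^sub>B then s - 1 - \<beta> (n - 1) else \<beta> (n - 1))" for n
  have "\<alpha> n \<in> digit_set s" for n
    using \<beta>[of "n - 1"] by (auto simp: \<alpha>_def digit_set_def)
  moreover have "(\<lambda>k. if Suc k \<in> N\<^sub>B then ?f (Suc k) else 0) sums (- x0_inf s N\<^sub>B)"
    using infsum_positive_positions_sums[OF summable_on_x0[OF assms(1)] assms(2)]
    by (simp add: x0_inf_def)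
  from sums_diff[OF sums_\<beta> this]
  have "(\<lambda>k. real (\<beta> k) / real s ^ Suc k - (if Suc k \<in> N\<^sub>B then ?f (Suc k) else 0)) sums x"
    by simp
  \<comment> \<open>On \<open>N\<^sub>B\<close> the exponent 1 of the sign turns the reflected digit
    into \<open>\<beta> k - (s - 1)\<close>; elsewhere the exponent 2 gives sign +1 and nothing is
    subtracted.\<close>
  moreover have "real (\<beta> k) / real s ^ Suc k - (if Suc k \<in> N\<^sub>B then ?f (Suc k) else 0) =
      (-1) ^ delta N\<^sub>B (Suc k) * real (\<alpha> (Suc k)) / real s ^ Suc k" for k
  proof -
    \<comment> \<open>The subtraction of naturals does not truncate, since a digit is at most
      \<open>s - 1\<close>.\<close>
    have "real (s - 1 - \<beta> k) = real s - 1 - real (\<beta> k)"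
      using \<beta>[of k] assms(1) by (auto simp: digit_set_def of_nat_diff)
    then show ?thesis
      by (simp add: \<alpha>_def delta_def diff_divide_distrib)
  qed
  ultimately have "(\<lambda>k. (-1) ^ delta N\<^sub>B (Suc k) * real (\<alpha> (Suc k)) / real s ^ Suc k) sums x"
    by (simp only:)
  with \<open>\<And>n. \<alpha> n \<in> digit_set s\<close> show ?thesis
    by blast
qed

end
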